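(* Let $n\ge2$, let $X$ be a continuous time irreducible Markov chain on $I=\{1,\ldots,n\}$ which is reversible with respect to its invariant distribution $\nu$, let $\|\cdot\|$ be a norm as described in the context, and fix $0<\epsilon<1$. Then the relations $\sim_1,\sim_2,\ldots$ on $I$ defined in the context are equivalence relations and define a sequence of nested partitions of $I$ (that is, $a\sim_{l}b$ implies $a\sim_{l+1}b$ for all $l\ge1$). Moreover, $a\sim_l b$ holds for any pair $(a,b)$ with $a\not\sim_{l-1}b$ which achieves the minimum in $$t^*_l=\min_{a\not\sim_{l-1} b}\ \inf\{t\geq0:\;\|P_t^a-\nu\|+\|P_t^b-\nu\|\leq\epsilon\},$$ and $a\sim_{n-1}b$ for any pair $(a,b)\in I^2$.
   Context: For $a\in I$, $t\ge0$, $P^a_t$ denotes the distribution of $X(t)$ when $X(0)=a$; $P_t$ is the transition matrix, and $\pi P_t$ is the law of $X(t)$ when $X(0)$ has law $\pi$. Norm: $\|\cdot\|$ is any norm on the space of finite (signed) measures on $I$ such that $\|\pi_1-\pi_2\|\le1$ for any two probability measures $\pi_1,\pi_2$ on $I$, and such that for all probability measures $\pi_1\ne\pi_2$ on $I$ the function $t\mapsto\|\pi_1P_t-\pi_2P_t\|$ is strictly decreasing on $[0,\infty)$ and tends to $0$ as $t\to\infty$. Relations: let $\sim_0$ be equality on $I$. Recursively, for $l\ge1$, given $\sim_{l-1}$, set $$t^*_l=\min_{a\not\sim_{l-1} b}\ \inf\{t\geq0:\;\|P_t^a-\nu\|+\|P_t^b-\nu\|\leq\epsilon\},$$ $$h^{(l)}_a(t)=\|P_{t^*_l}^a-\nu\|^k\cdot\|P_s^a-\nu\|\quad\text{for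 } t=kt^*_l+s,\ k\in\{0,1,2,\ldots\},\ 0\le s<t^*_l,\ a\in I,$$ and let $a\sim_l b$ if and only if either $a\sim_{l-1}b$, or $$\limsup_{t\to\infty}\frac{t^*_l}{t}\log\big[h^{(l)}_a(t)+h^{(l)}_b(t)\big]\le\log(2\epsilon).$$ It is understood that $t^*_1>0$, so that the functions $h^{(l)}_a$ are well defined, and that if $\sim_{l-1}$ already identifies all states (so that the minimum is over an empty set), then $\sim_l$ is equal to $\sim_{l-1}$. *)

theory Defs
  imports "HOL-Probability.Probability"
begin

text \<open>
  The finite state space \<open>I\<close> is a finite type \<open>'n\<close>. Finite signed measures on \<open>I\<close> are
  identified with their vectors of point masses in \<open>real ^ 'n\<close>.
\<close>

definition prob_vec :: "real ^ 'n \<Rightarrow> bool" where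
  "prob_vec p \<longleftrightarrow> (\<forall>i. 0 \<le> p $ i) \<and> (\<Sum>i\<in>UNIV. p $ i) = 1"

text \<open>
  A chain is given by its Markov family: \<open>M a\<close> is the underlying probability space when
  \<open>X(0) = a\<close>. The process is indexed by all reals, but only times \<open>t \<ge> 0\<close> are constrained.
  In the Markov property, \<open>u m\<close> is the present, \<open>u 0, \<dots>, u (m - 1)\<close> are times in the past
  and \<open>u (Suc m)\<close> is in the future; \<open>\<P>(\<dots> in \<dots>. \<dots> \<bar> \<dots>)\<close> is conditional probability.
\<close>

definition markov_chain :: "('n::finite \<Rightarrow> 'w measure) \<Rightarrow> (real \<Rightarrow> 'w \<Rightarrow> 'n) \<Rightarrow> bool" where
  "markov_chain M X \<longleftrightarrow>
     (\<forall>a. prob_space (M a)) \<and>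
     (\<forall>a. \<forall>t\<ge>0. X t \<in> M a \<rightarrow>\<^sub>M count_space UNIV) \<and>
     (\<forall>a. AE w in M a. X 0 w = a) \<and>
     (\<forall>a. AE w in M a. \<forall>t\<ge>0. \<forall>\<^sub>F s in at_right t. X s w = X t w) \<and>
     (\<forall>a (m::nat) (u :: nat \<Rightarrow> real) (x :: nat \<Rightarrow> 'n).
        0 \<le> u 0 \<longrightarrow> (\<forall>i\<le>m. u i < u (Suc i)) \<longrightarrow>
        \<P>(w in M a. \<forall>i\<le>m. X (u i) w = x i) > 0 \<longrightarrow>
        \<P>(w in M a. X (u (Suc m)) w = x (Suc m) \<bar> \<forall>i\<le>m. X (u i) w = x i)
          = \<P>(w in M (x m). X (u (Suc m) - u m) w = x (Suc m)))"

text \<open>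
  Row \<open>a\<close> of \<open>transition_matrix M X t\<close> is the distribution of \<open>X(t)\<close> started at \<open>a\<close>;
  hence \<open>p v* transition_matrix M X t\<close> is the law of \<open>X(t)\<close> for initial law \<open>p\<close>.
\<close>

definition transition_matrix ::
  "('n::finite \<Rightarrow> 'w measure) \<Rightarrow> (real \<Rightarrow> 'w \<Rightarrow> 'n) \<Rightarrow> real \<Rightarrow> real ^ 'n ^ 'n" where
  "transition_matrix M X t = (\<chi> a b. \<P>(w in M a. X t w = b))"

definition irreducible_chain :: "(real \<Rightarrow> real ^ 'n ^ 'n) \<Rightarrow> bool" where
  "irreducible_chain P \<longleftrightarrow> (\<forall>a b. \<exists>t\<ge>0. P t $ a $ b > 0)"

definition invariant_distribution :: "(real \<Rightarrow> real ^ 'n ^ 'n) \<Rightarrow> real ^ 'n \<Rightarrow> bool" where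
  "invariant_distribution P \<nu> \<longleftrightarrow> prob_vec \<nu> \<and> (\<forall>t\<ge>0. \<nu> v* P t = \<nu>)"

definition reversible_wrt :: "(real \<Rightarrow> real ^ 'n ^ 'n) \<Rightarrow> real ^ 'n \<Rightarrow> bool" where
  "reversible_wrt P \<nu> \<longleftrightarrow> (\<forall>t\<ge>0. \<forall>a b. \<nu> $ a * P t $ a $ b = \<nu> $ b * P t $ b $ a)"

definition is_norm :: "('v::real_vector \<Rightarrow> real) \<Rightarrow> bool" where
  "is_norm N \<longleftrightarrow>
     (\<forall>x. 0 \<le> N x) \<and> (\<forall>x. N x = 0 \<longleftrightarrow> x = 0) \<and>
     (\<forall>c x. N (c *\<^sub>R x) = \<bar>c\<bar> * N x) \<and> (\<forall>x y. N (x + y) \<le> N x + N y)"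

definition admissible_norm :: "(real \<Rightarrow> real ^ 'n ^ 'n) \<Rightarrow> (real ^ 'n \<Rightarrow> real) \<Rightarrow> bool" where
  "admissible_norm P N \<longleftrightarrow>
     is_norm N \<and>
     (\<forall>p q. prob_vec p \<longrightarrow> prob_vec q \<longrightarrow> N (p - q) \<le> 1) \<and>
     (\<forall>p q. prob_vec p \<longrightarrow> prob_vec q \<longrightarrow> p \<noteq> q \<longrightarrow>
        strict_antimono_on {0..} (\<lambda>t. N (p v* P t - q v* P t)) \<and>
        ((\<lambda>t. N (p v* P t - q v* P t)) \<longlongrightarrow> 0) at_top)"

definition pair_time ::
  "(real \<Rightarrow> real ^ 'n ^ 'n) \<Rightarrow> real ^ 'n \<Rightarrow> (real ^ 'n \<Rightarrow> real) \<Rightarrow> real \<Rightarrow> 'n \<Rightarrow> 'n \<Rightarrow> real" where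
  "pair_time P \<nu> N \<epsilon> a b = Inf {t. 0 \<le> t \<and> N (P t $ a - \<nu>) + N (P t $ b - \<nu>) \<le> \<epsilon>}"

text \<open>Only meaningful if \<open>R\<close> does not identify all states.\<close>

definition min_time ::
  "(real \<Rightarrow> real ^ 'n ^ 'n) \<Rightarrow> real ^ 'n \<Rightarrow> (real ^ 'n \<Rightarrow> real) \<Rightarrow> real \<Rightarrow>
   ('n::finite \<Rightarrow> 'n \<Rightarrow> bool) \<Rightarrow> real" where
  "min_time P \<nu> N \<epsilon> R = Min {pair_time P \<nu> N \<epsilon> a b | a b. \<not> R a b}"

text \<open>\<open>\<tau>\<close> is the period; for \<open>t \<ge> 0\<close>, the \<open>k\<close> and \<open>s\<close> below are the unique ones with
  \<open>t = k \<tau> + s\<close> and \<open>0 \<le> s < \<tau>\<close>.\<close>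

definition iter_dist ::
  "(real \<Rightarrow> real ^ 'n ^ 'n) \<Rightarrow> real ^ 'n \<Rightarrow> (real ^ 'n \<Rightarrow> real) \<Rightarrow> real \<Rightarrow> 'n \<Rightarrow> real \<Rightarrow> real" where
  "iter_dist P \<nu> N \<tau> a t =
     (let k = nat \<lfloor>t / \<tau>\<rfloor>; s = t - real k * \<tau>
      in N (P \<tau> $ a - \<nu>) ^ k * N (P s $ a - \<nu>))"

text \<open>If \<open>sim l\<close> already identifies all states, the first disjunct always holds, so that
  \<open>sim (Suc l)\<close> equals \<open>sim l\<close> whatever the value of \<open>min_time\<close>.\<close>

primrec sim ::
  "(real \<Rightarrow> real ^ 'n ^ 'n) \<Rightarrow> real ^ 'n \<Rightarrow> (real ^ 'n \<Rightarrow> real) \<Rightarrow> real \<Rightarrow>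
   nat \<Rightarrow> 'n::finite \<Rightarrow> 'n \<Rightarrow> bool" where
  "sim P \<nu> N \<epsilon> 0 = (\<lambda>a b. a = b)"
| "sim P \<nu> N \<epsilon> (Suc l) = (\<lambda>a b.
     sim P \<nu> N \<epsilon> l a b \<or>
     (let \<tau> = min_time P \<nu> N \<epsilon> (sim P \<nu> N \<epsilon> l)
      in Limsup at_top
           (\<lambda>t. ereal (\<tau> / t * ln (iter_dist P \<nu> N \<tau> a t + iter_dist P \<nu> N \<tau> b t)))
         \<le> ereal (ln (2 * \<epsilon>))))"

text \<open>The time \<open>t*\<^sub>l\<close>, for \<open>l \<ge> 1\<close>.\<close>

definition tstar ::
  "(real \<Rightarrow> real ^ 'n ^ 'n) \<Rightarrow> real ^ 'n \<Rightarrow> (real ^ 'n::finite \<Rightarrow> real) \<Rightarrow> real \<Rightarrow> nat \<Rightarrow> real" where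
  "tstar P \<nu> N \<epsilon> l = min_time P \<nu> N \<epsilon> (sim P \<nu> N \<epsilon> (l - 1))"

end

theory Submission
  imports Defs
begin

text \<open>
  Write \<open>D a t\<close> for \<open>\<parallel>P\<^sub>t\<^sup>a - \<nu>\<parallel>\<close>. Since \<open>D a\<close> is decreasing with values in \<open>(0, 1]\<close>, the
  function \<open>h\<close> of state \<open>a\<close> with period \<open>\<tau>\<close> decays like \<open>D a \<tau>\<close> to the power \<open>t / \<tau>\<close>, and the
  limit superior in the definition of the relations equals \<open>ln (max (D a \<tau>) (D b \<tau>))\<close>. So the
  \<open>l\<close>-th step identifies exactly the states in \<open>{a. D a \<tau> \<le> 2 \<epsilon>}\<close> for \<open>\<tau> = t\<^sup>*\<^sub>l\<close>. The times
  \<open>t\<^sup>*\<^sub>l\<close> increase with \<open>l\<close>, hence so do these sets: each relation has a single nontrivial class.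
  As \<open>D\<close> is right-continuous, a minimising pair satisfies \<open>D a \<tau> + D b \<tau> \<le> \<epsilon>\<close>, so it joins that
  class, which therefore grows by at least one state in each step.
\<close>

text \<open>All the later argument needs from the chain and the norm. Right-continuity along
  \<open>t + 1 / real (Suc n)\<close> suffices: it serves only to show that an infimum of times is
  attained.\<close>

locale decaying_distances =
  fixes P :: "real \<Rightarrow> real ^ 'n::finite ^ 'n" and \<nu> :: "real ^ 'n" and N :: "real ^ 'n \<Rightarrow> real"
    and \<epsilon> :: real
  assumes dist_le_1: "0 \<le> t \<Longrightarrow> N (P t $ a - \<nu>) \<le> 1"
    and dist_strict_antimono:
      "0 \<le> s \<Longrightarrow> s < t \<Longrightarrow> N (P t $ a - \<nu>) < N (P s $ a - \<nu>)"
    and dist_nonneg: "0 \<le> N (P t $ a - \<nu>)"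
    and dist_tendsto_0: "((\<lambda>t. N (P t $ a - \<nu>)) \<longlongrightarrow> 0) at_top"
    and dist_right_continuous:
      "0 \<le> t \<Longrightarrow> (\<lambda>n. N (P (t + 1 / real (Suc n)) $ a - \<nu>)) \<longlonglongrightarrow> N (P t $ a - \<nu>)"
    and eps_pos: "0 < \<epsilon>"
begin

abbreviation D :: "'n \<Rightarrow> real \<Rightarrow> real" where "D a t \<equiv> N (P t $ a - \<nu>)"

text \<open>A strictly decreasing nonnegative function never vanishes; this keeps the logarithms
  below meaningful.\<close>

lemma dist_pos: "0 \<le> t \<Longrightarrow> 0 < D a t"
  using dist_strict_antimono[of t "t + 1" a] dist_nonneg[of "t + 1" a] by linarith

lemma dist_antimono: "0 \<le> s \<Longrightarrow> s \<le> t \<Longrightarrow> D a t \<le> D a s"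
  using dist_strict_antimono[of s t a] by (cases "s = t") auto

section \<open>Exponential decay rate of the iterated distances\<close>

lemma iter_dist_bounds:
  fixes a :: 'n
  assumes "0 < \<tau>" "0 \<le> t"
  defines "k \<equiv> nat \<lfloor>t / \<tau>\<rfloor>"
  shows "D a \<tau> ^ Suc k \<le> iter_dist P \<nu> N \<tau> a t" "iter_dist P \<nu> N \<tau> a t \<le> D a \<tau> ^ k"
proof -
  define s where "s = t - real k * \<tau>"
  have "real k = of_int \<lfloor>t / \<tau>\<rfloor>" using assms by simp
  then have "real k \<le> t / \<tau>" "t / \<tau> < real k + 1" by linarith+
  then have "real k * \<tau> \<le> t" "t < (real k + 1) * \<tau>"
    using \<open>0 < \<tau>\<close> by (simp_all add: pos_le_divide_eq pos_divide_less_eq)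
  then have s: "0 \<le> s" "s \<le> \<tau>" by (simp_all add: s_def algebra_simps)
  have eq: "iter_dist P \<nu> N \<tau> a t = D a \<tau> ^ k * D a s"
    by (simp add: iter_dist_def Let_def k_def s_def)
  \<comment> \<open>The factor of the remainder \<open>s\<close> lies between
    \<open>D a \<tau>\<close>, by monotonicity, and 1.\<close>
  have "D a \<tau> ^ k * D a \<tau> \<le> D a \<tau> ^ k * D a s"
    using s by (intro mult_left_mono dist_antimono) (auto simp: dist_nonneg)
  then show "D a \<tau> ^ Suc k \<le> iter_dist P \<nu> N \<tau> a t" by (simp add: eq mult.commute)
  have "D a \<tau> ^ k * D a s \<le> D a \<tau> ^ k * 1"
    using s by (intro mult_left_mono dist_le_1) (auto simp: dist_nonneg)
  then show "iter_dist P \<nu> N \<tau> a t \<le> D a \<tau> ^ k" by (simp add: eq)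
qed

text \<open>The sum \<open>h\<close> lies between \<open>m ^ Suc k\<close> and
  \<open>2 * m ^ k\<close>, and \<open>k\<close> differs from \<open>t / \<tau>\<close> by at most
  1. So \<open>ln h\<close> is \<open>t / \<tau> * ln m\<close> up to a bounded error.\<close>

lemma ln_iter_dist_bounds:
  fixes a b :: 'n
  assumes "0 < \<tau>" "0 \<le> t"
  defines "m \<equiv> max (D a \<tau>) (D b \<tau>)"
  defines "h \<equiv> iter_dist P \<nu> N \<tau> a t + iter_dist P \<nu> N \<tau> b t"
  shows "(t / \<tau> + 1) * ln m \<le> ln h" "ln h \<le> ln 2 + (t / \<tau> - 1) * ln m"
proof -
  define k where "k = nat \<lfloor>t / \<tau>\<rfloor>"
  have "real k = of_int \<lfloor>t / \<tau>\<rfloor>" using assms by (simp add: k_def)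
  then have k: "real k \<le> t / \<tau>" "t / \<tau> - 1 \<le> real k" by linarith+
  note ia = iter_dist_bounds[OF assms(1,2), of a, folded k_def]
  note ib = iter_dist_bounds[OF assms(1,2), of b, folded k_def]
  have pos: "0 < D a \<tau>" "0 < D b \<tau>" using assms dist_pos by auto
  then have m0: "0 < m" by (simp add: m_def)
  have "m \<le> 1" using assms(1) dist_le_1[of \<tau>] by (simp add: m_def)
  then have lnm: "ln m \<le> 0" using m0 by simp
  have "0 \<le> iter_dist P \<nu> N \<tau> a t" "0 \<le> iter_dist P \<nu> N \<tau> b t"
    using ia(1) ib(1) pos by (meson less_imp_le order_trans zero_le_power)+
  then have low: "m ^ Suc k \<le> h"
    using ia(1) ib(1) unfolding m_def h_def max_def by auto
  have "D a \<tau> ^ k \<le> m ^ k" "D b \<tau> ^ k \<le> m ^ k"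
    using pos by (auto simp: m_def intro!: power_mono)
  then have up: "h \<le> 2 * m ^ k" using ia(2) ib(2) by (simp add: h_def)
  have mk: "0 < m ^ Suc k" "0 < m ^ k" using m0 by auto
  then have h0: "0 < h" using low by linarith
  \<comment> \<open>As \<open>ln m \<le> 0\<close>, an upper bound on \<open>k\<close> gives a lower
    bound here, and conversely below.\<close>
  have "(t / \<tau> + 1) * ln m \<le> real (Suc k) * ln m"
    using k lnm by (intro mult_right_mono_neg) auto
  also have "\<dots> = ln (m ^ Suc k)" using m0 by (subst ln_realpow) auto
  also have "\<dots> \<le> ln h" using low mk h0 by simp
  finally show "(t / \<tau> + 1) * ln m \<le> ln h" .
  have "ln h \<le> ln (2 * m ^ k)" using up h0 mk by simp
  also have "\<dots> = ln 2 + real k * ln m" using m0 by (simp add: ln_mult ln_realpow)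
  also have "\<dots> \<le> ln 2 + (t / \<tau> - 1) * ln m"
    using k lnm by (intro add_left_mono mult_right_mono_neg) auto
  finally show "ln h \<le> ln 2 + (t / \<tau> - 1) * ln m" .
qed

lemma decay_rate_tendsto:
  assumes \<tau>: "0 < \<tau>"
  shows "((\<lambda>t. \<tau> / t * ln (iter_dist P \<nu> N \<tau> a t + iter_dist P \<nu> N \<tau> b t))
    \<longlongrightarrow> ln (max (D a \<tau>) (D b \<tau>))) at_top"
proof -
  let ?m = "ln (max (D a \<tau>) (D b \<tau>))"
  have lim: "((\<lambda>t. x / t) \<longlongrightarrow> 0) at_top" for x :: real
    by (intro tendsto_divide_0[OF tendsto_const] filterlim_at_top_imp_at_infinity filterlim_ident)
  \<comment> \<open>The two logarithmic bounds multiplied by \<open>\<tau> / t\<close>: their errors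
    are constants over \<open>t\<close>.\<close>
  have "((\<lambda>t. ?m + \<tau> * ?m / t) \<longlongrightarrow> ?m + 0) at_top"
    by (intro tendsto_intros lim)
  moreover have "((\<lambda>t. ?m + \<tau> * (ln 2 - ?m) / t) \<longlongrightarrow> ?m + 0) at_top"
    by (intro tendsto_intros lim)
  moreover have "\<forall>\<^sub>F t in at_top.
      ?m + \<tau> * ?m / t \<le> \<tau> / t * ln (iter_dist P \<nu> N \<tau> a t + iter_dist P \<nu> N \<tau> b t)"
    using eventually_gt_at_top[of 0]
  proof eventually_elim
    case (elim t)
    have "?m + \<tau> * ?m / t = \<tau> / t * ((t / \<tau> + 1) * ?m)"
      using \<tau> elim by (simp add: field_simps)
    also have "\<dots> \<le> \<tau> / t * ln (iter_dist P \<nu> N \<tau> a t + iter_dist P \<nu> N \<tau> b t)"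
      using \<tau> elim by (intro mult_left_mono ln_iter_dist_bounds) auto
    finally show ?case .
  qed
  moreover have "\<forall>\<^sub>F t in at_top.
      \<tau> / t * ln (iter_dist P \<nu> N \<tau> a t + iter_dist P \<nu> N \<tau> b t) \<le> ?m + \<tau> * (ln 2 - ?m) / t"
    using eventually_gt_at_top[of 0]
  proof eventually_elim
    case (elim t)
    have "\<tau> / t * ln (iter_dist P \<nu> N \<tau> a t + iter_dist P \<nu> N \<tau> b t)
        \<le> \<tau> / t * (ln 2 + (t / \<tau> - 1) * ?m)"
      using \<tau> elim by (intro mult_left_mono ln_iter_dist_bounds) auto
    also have "\<dots> = ?m + \<tau> * (ln 2 - ?m) / t"
      using \<tau> elim by (simp add: field_simps)
    finally show ?case .
  qed
  ultimately show ?thesis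
    using tendsto_sandwich[of "\<lambda>t. ?m + \<tau> * ?m / t"] by fastforce
qed

text \<open>The limit superior is a limit, and monotonicity of \<open>ln\<close> turns the bound on
  a maximum into separate conditions on \<open>a\<close> and \<open>b\<close>. This separation is
  what makes the relation come from a set of states.\<close>

lemma Limsup_decay_rate_le_iff:
  assumes \<tau>: "0 < \<tau>"
  shows "Limsup at_top (\<lambda>t. ereal (\<tau> / t * ln (iter_dist P \<nu> N \<tau> a t + iter_dist P \<nu> N \<tau> b t)))
      \<le> ereal (ln (2 * \<epsilon>)) \<longleftrightarrow> D a \<tau> \<le> 2 * \<epsilon> \<and> D b \<tau> \<le> 2 * \<epsilon>"
proof -
  have "Limsup at_top (\<lambda>t. ereal (\<tau> / t * ln (iter_dist P \<nu> N \<tau> a t + iter_dist P \<nu> N \<tau> b t)))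
      = ereal (ln (max (D a \<tau>) (D b \<tau>)))"
    by (intro lim_imp_Limsup tendsto_ereal decay_rate_tendsto \<tau>) simp
  moreover have "0 < max (D a \<tau>) (D b \<tau>)" using dist_pos[of \<tau> a] \<tau> by simp
  ultimately show ?thesis using eps_pos by simp
qed

section \<open>Pair times and their minimum over unrelated pairs\<close>

lemma dist_sum_at_pair_time:
  "0 \<le> pair_time P \<nu> N \<epsilon> a b \<and>
   D a (pair_time P \<nu> N \<epsilon> a b) + D b (pair_time P \<nu> N \<epsilon> a b) \<le> \<epsilon>"
proof -
  let ?A = "{t. 0 \<le> t \<and> D a t + D b t \<le> \<epsilon>}"
  define T where "T = pair_time P \<nu> N \<epsilon> a b"
  have T: "T = Inf ?A" by (simp add: T_def pair_time_def)
  have "((\<lambda>t. D a t + D b t) \<longlongrightarrow> 0 + 0) at_top"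
    by (intro tendsto_add dist_tendsto_0)
  then have "\<forall>\<^sub>F t in at_top. D a t + D b t < \<epsilon>"
    using eps_pos by (intro order_tendstoD(2)) auto
  then have "\<forall>\<^sub>F t in at_top. D a t + D b t < \<epsilon> \<and> 0 \<le> t"
    using eventually_ge_at_top[of 0] by eventually_elim auto
  then obtain t0 where "D a t0 + D b t0 < \<epsilon>" "0 \<le> t0"
    by (metis (mono_tags, lifting) eventually_at_top_linorder order_refl)
  \<comment> \<open>Only for a nonempty set does \<open>Inf\<close> behave as an infimum.\<close>
  then have ne: "?A \<noteq> {}" by force
  then have T0: "0 \<le> T" unfolding T by (intro cInf_greatest) auto
  \<comment> \<open>Some admissible time precedes any time after \<open>T\<close>, and the distances
    decrease; letting \<open>n\<close> grow then gives the bound at \<open>T\<close> itself.\<close>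
  have le: "D a (T + 1 / real (Suc n)) + D b (T + 1 / real (Suc n)) \<le> \<epsilon>" for n
  proof -
    have "Inf ?A < T + 1 / real (Suc n)" by (simp add: T)
    then obtain t where t: "t \<in> ?A" "t < T + 1 / real (Suc n)"
      using cInf_lessD[OF ne] by blast
    then show ?thesis
      using dist_antimono[of t "T + 1 / real (Suc n)" a]
        dist_antimono[of t "T + 1 / real (Suc n)" b] by auto
  qed
  have "(\<lambda>n. D a (T + 1 / real (Suc n)) + D b (T + 1 / real (Suc n))) \<longlonglongrightarrow> D a T + D b T"
    using T0 by (intro tendsto_add dist_right_continuous)
  then have "D a T + D b T \<le> \<epsilon>" by (rule LIMSEQ_le_const2) (use le in blast)
  with T0 show ?thesis by (simp add: T_def)
qed

lemma finite_pair_times: "finite {pair_time P \<nu> N \<epsilon> a b | a b. \<not> R a b}"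
  by (rule finite_subset[of _ "(\<lambda>(a, b). pair_time P \<nu> N \<epsilon> a b) ` UNIV"]) auto

lemma min_time_le: "\<not> R a b \<Longrightarrow> min_time P \<nu> N \<epsilon> R \<le> pair_time P \<nu> N \<epsilon> a b"
  unfolding min_time_def by (intro Min_le finite_pair_times) auto

lemma min_time_attained:
  assumes "\<not> R a b"
  obtains c d where "\<not> R c d" "pair_time P \<nu> N \<epsilon> c d = min_time P \<nu> N \<epsilon> R"
proof -
  have "min_time P \<nu> N \<epsilon> R \<in> {pair_time P \<nu> N \<epsilon> a b | a b. \<not> R a b}"
    unfolding min_time_def by (intro Min_in finite_pair_times) (use assms in auto)
  then show thesis using that by force
qed

text \<open>A coarser relation leaves fewer pairs to minimise over. The pair unrelated by
  \<open>R'\<close> keeps both minima over nonempty sets.\<close>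

lemma min_time_mono:
  assumes "\<not> R' a b" "\<And>a b. R a b \<Longrightarrow> R' a b"
  shows "min_time P \<nu> N \<epsilon> R \<le> min_time P \<nu> N \<epsilon> R'"
  using assms min_time_le by (metis min_time_attained)

section \<open>The relations and the growth of their single class\<close>

lemma sim_mono: "l \<le> l' \<Longrightarrow> sim P \<nu> N \<epsilon> l a b \<Longrightarrow> sim P \<nu> N \<epsilon> l' a b"
  by (induction l' rule: dec_induct) auto

context
  assumes tstar_1_pos: "0 < tstar P \<nu> N \<epsilon> 1"
begin

lemma min_time_sim_pos:
  assumes "\<not> sim P \<nu> N \<epsilon> l a b"
  shows "0 < min_time P \<nu> N \<epsilon> (sim P \<nu> N \<epsilon> l)"
proof -
  have "min_time P \<nu> N \<epsilon> (sim P \<nu> N \<epsilon> 0) \<le> min_time P \<nu> N \<epsilon> (sim P \<nu> N \<epsilon> l)"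
    by (rule min_time_mono[of "sim P \<nu> N \<epsilon> l", OF assms]) (use sim_mono[of 0 l] in auto)
  then show ?thesis using tstar_1_pos by (simp add: tstar_def)
qed

text \<open>The pair \<open>a0\<close>, \<open>b0\<close> only certifies that \<open>\<tau>\<close>
  is a genuine, hence positive, minimum, so that the decay criterion applies to every
  \<open>a\<close>, \<open>b\<close>.\<close>

lemma sim_Suc_iff:
  assumes "\<not> sim P \<nu> N \<epsilon> l a0 b0"
  defines "\<tau> \<equiv> min_time P \<nu> N \<epsilon> (sim P \<nu> N \<epsilon> l)"
  shows "sim P \<nu> N \<epsilon> (Suc l) a b \<longleftrightarrow>
    sim P \<nu> N \<epsilon> l a b \<or> D a \<tau> \<le> 2 * \<epsilon> \<and> D b \<tau> \<le> 2 * \<epsilon>"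
  using Limsup_decay_rate_le_iff[OF min_time_sim_pos[OF assms(1)], of a b]
  by (simp add: \<tau>_def Let_def)

text \<open>The two nonnegative distances add up to at most \<open>\<epsilon>\<close> at the
  attained infimum, so each is at most \<open>\<epsilon>\<close>.\<close>

lemma sim_Suc_minimizer:
  assumes "\<not> sim P \<nu> N \<epsilon> l a b"
    and "pair_time P \<nu> N \<epsilon> a b = min_time P \<nu> N \<epsilon> (sim P \<nu> N \<epsilon> l)"
  defines "\<tau> \<equiv> min_time P \<nu> N \<epsilon> (sim P \<nu> N \<epsilon> l)"
  shows "D a \<tau> \<le> 2 * \<epsilon>" "D b \<tau> \<le> 2 * \<epsilon>"
  using dist_sum_at_pair_time[of a b] dist_nonneg[of \<tau> a] dist_nonneg[of \<tau> b] eps_pos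
  unfolding assms(2) \<tau>_def by auto

text \<open>
  \<open>S\<close> is the only class of \<open>\<sim>\<^sub>l\<close> that may have more than one element. The clause on \<open>D\<close> says
  that \<open>S\<close> is contained in the corresponding class at the next step.
\<close>

lemma sim_single_class:
  obtains S where
    "\<And>a b. sim P \<nu> N \<epsilon> l a b \<longleftrightarrow> a = b \<or> a \<in> S \<and> b \<in> S"
    "S = UNIV \<or> (\<forall>a\<in>S. D a (min_time P \<nu> N \<epsilon> (sim P \<nu> N \<epsilon> l)) \<le> 2 * \<epsilon>)"
    "S = UNIV \<or> l = 0 \<or> l < card S"
proof (induction l arbitrary: thesis)
  case 0
  \<comment> \<open>The empty class encodes equality; hence the exception \<open>l = 0\<close> in
    the cardinality clause.\<close>
  show ?case by (rule 0[of "{}"]) auto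
next
  case (Suc l)
  obtain S where S: "\<And>a b. sim P \<nu> N \<epsilon> l a b \<longleftrightarrow> a = b \<or> a \<in> S \<and> b \<in> S"
      "S = UNIV \<or> (\<forall>a\<in>S. D a (min_time P \<nu> N \<epsilon> (sim P \<nu> N \<epsilon> l)) \<le> 2 * \<epsilon>)"
      "S = UNIV \<or> l = 0 \<or> l < card S"
    using Suc.IH by blast
  show ?case
  proof (cases "\<forall>a b. sim P \<nu> N \<epsilon> l a b")
    case True
    show ?thesis by (rule Suc.prems[of UNIV]) (use True in auto)
  next
    case False
    define \<tau> where "\<tau> = min_time P \<nu> N \<epsilon> (sim P \<nu> N \<epsilon> l)"
    define S' where "S' = {a. D a \<tau> \<le> 2 * \<epsilon>}"
    obtain a0 b0 where "\<not> sim P \<nu> N \<epsilon> l a0 b0" using False by blast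
    then obtain a b where ab: "\<not> sim P \<nu> N \<epsilon> l a b" "pair_time P \<nu> N \<epsilon> a b = \<tau>"
      unfolding \<tau>_def by (rule min_time_attained)
    have mem: "a \<in> S'" "b \<in> S'"
      using sim_Suc_minimizer[of l a b] ab by (auto simp: S'_def \<tau>_def)
    have "S \<noteq> UNIV" using ab(1) S(1) by auto
    then have sub: "S \<subseteq> S'" using S(2) by (auto simp: S'_def \<tau>_def)
    have sim': "sim P \<nu> N \<epsilon> (Suc l) c d \<longleftrightarrow> c = d \<or> c \<in> S' \<and> d \<in> S'" for c d
      using sim_Suc_iff[OF ab(1), of c d] S(1) sub by (auto simp: S'_def \<tau>_def)
    \<comment> \<open>For \<open>l = 0\<close> the two distinct minimisers give
      \<open>card S' \<ge> 2\<close>; for larger \<open>l\<close> the strict inclusion adds one to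
      the previous bound.\<close>
    have "\<not> (a \<in> S \<and> b \<in> S)" "a \<noteq> b" using ab(1) S(1) by auto
    then have "S \<subset> S'" "card {a, b} = 2" using sub mem by auto
    moreover have "card {a, b} \<le> card S'" using mem by (intro card_mono) auto
    moreover have "card S < card S'" using \<open>S \<subset> S'\<close> by (intro psubset_card_mono) auto
    ultimately have card: "Suc l < card S'" using S(3) \<open>S \<noteq> UNIV\<close> by auto
    have "D c (min_time P \<nu> N \<epsilon> (sim P \<nu> N \<epsilon> (Suc l))) \<le> 2 * \<epsilon>" if ne: "S' \<noteq> UNIV" and c: "c \<in> S'" for c
    proof -
      \<comment> \<open>A state outside \<open>S'\<close> leaves an unrelated pair, so the next
        minimum is genuine and at least \<open>\<tau>\<close>; by then the distances have only
        decreased.\<close>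
      obtain e where "e \<notin> S'" using ne by blast
      then have "\<not> sim P \<nu> N \<epsilon> (Suc l) e c" using c by (auto simp only: sim')
      then have "\<tau> \<le> min_time P \<nu> N \<epsilon> (sim P \<nu> N \<epsilon> (Suc l))"
        unfolding \<tau>_def by (rule min_time_mono) simp
      moreover have "0 < \<tau>" unfolding \<tau>_def by (rule min_time_sim_pos[OF ab(1)])
      ultimately show ?thesis
        using dist_antimono[of \<tau> "min_time P \<nu> N \<epsilon> (sim P \<nu> N \<epsilon> (Suc l))" c] c
        unfolding S'_def by auto
    qed
    then show ?thesis using sim' card by (intro Suc.prems[of S']) auto
  qed
qed

text \<open>Transitivity is not visible from the recursion, as a union of two equivalences need not
  be transitive; the single class provides it.\<close>

lemma equivp_sim: "equivp (sim P \<nu> N \<epsilon> l)"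
proof -
  obtain S where "\<And>a b. sim P \<nu> N \<epsilon> l a b \<longleftrightarrow> a = b \<or> a \<in> S \<and> b \<in> S"
    by (rule sim_single_class[of l]) (rule that)
  then show ?thesis by (intro equivpI reflpI sympI transpI) auto
qed

lemma sim_minimizer:
  assumes "\<not> sim P \<nu> N \<epsilon> l a b"
    and "pair_time P \<nu> N \<epsilon> a b = min_time P \<nu> N \<epsilon> (sim P \<nu> N \<epsilon> l)"
  shows "sim P \<nu> N \<epsilon> (Suc l) a b"
  using sim_Suc_minimizer[OF assms] sim_Suc_iff[OF assms(1)] by simp

text \<open>A class other than \<open>UNIV\<close> would need more than \<open>CARD('n) - 1\<close>
  states. Two states or more rule out the exceptional index 0.\<close>

lemma sim_total:
  assumes "CARD('n) \<ge> 2"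
  shows "sim P \<nu> N \<epsilon> (CARD('n) - 1) a b"
proof -
  obtain S where S: "\<And>a b. sim P \<nu> N \<epsilon> (CARD('n) - 1) a b \<longleftrightarrow> a = b \<or> a \<in> S \<and> b \<in> S"
    "S = UNIV \<or> CARD('n) - 1 = 0 \<or> CARD('n) - 1 < card S"
    by (rule sim_single_class[of "CARD('n) - 1"]) (rule that)
  have "S = UNIV"
  proof (rule ccontr)
    assume "S \<noteq> UNIV"
    then have "card S < CARD('n)" by (intro psubset_card_mono) auto
    then show False using S(2) \<open>S \<noteq> UNIV\<close> assms by linarith
  qed
  then show ?thesis by (simp only: S(1) UNIV_I simp_thms)
qed

end

end

section \<open>Properties of the transition matrices and of the norm\<close>

lemma prob_vec_transition_matrix:
  fixes M :: "'n::finite \<Rightarrow> 'w measure"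
  assumes "markov_chain M X" "0 \<le> t"
  shows "prob_vec (transition_matrix M X t $ a)"
proof -
  interpret prob_space "M a" using assms by (simp add: markov_chain_def)
  have meas: "X t \<in> M a \<rightarrow>\<^sub>M count_space UNIV" using assms by (simp add: markov_chain_def)
  have ev: "{w \<in> space (M a). X t w = b} \<in> events" for b
    using measurable_sets[OF meas, of "{b}"] by (simp add: vimage_def Int_def conj_commute)
  have "(\<Sum>b\<in>UNIV. prob {w \<in> space (M a). X t w = b})
      = prob (\<Union>b. {w \<in> space (M a). X t w = b})"
    using ev by (intro finite_measure_finite_Union[symmetric]) (auto simp: disjoint_family_on_def)
  also have "(\<Union>b. {w \<in> space (M a). X t w = b}) = space (M a)" by auto
  finally show ?thesis by (simp add: prob_vec_def transition_matrix_def prob_space)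
qed

text \<open>Almost every path is constant just after \<open>t\<close>, so the indicators of
  \<open>X (r n) w = b\<close> are eventually constant in \<open>n\<close>; dominated convergence
  with bound 1 finishes.\<close>

lemma transition_matrix_right_continuous:
  fixes M :: "'n::finite \<Rightarrow> 'w measure"
  assumes mc: "markov_chain M X" and t: "0 \<le> t"
  shows "(\<lambda>n. transition_matrix M X (t + 1 / real (Suc n)) $ a $ b)
    \<longlonglongrightarrow> transition_matrix M X t $ a $ b"
proof -
  interpret prob_space "M a" using mc by (simp add: markov_chain_def)
  define r where "r n = t + 1 / real (Suc n)" for n
  have meas: "X s \<in> M a \<rightarrow>\<^sub>M count_space UNIV" if "0 \<le> s" for s
    using mc that by (simp add: markov_chain_def)
  have ev: "{w \<in> space (M a). X s w = b} \<in> events" if "0 \<le> s" for s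
    using measurable_sets[OF meas[OF that], of "{b}"]
    by (simp add: vimage_def Int_def conj_commute)
  have r: "0 \<le> r n" for n using t by (simp add: r_def)
  have "(\<lambda>n. 1 / real (Suc n)) \<longlonglongrightarrow> 0"
    using LIMSEQ_inverse_real_of_nat by (simp add: inverse_eq_divide)
  then have "r \<longlonglongrightarrow> t + 0" unfolding r_def by (intro tendsto_add tendsto_const)
  then have "filterlim r (at_right t) sequentially"
    unfolding filterlim_at by (auto simp: r_def)
  moreover have "AE w in M a. \<forall>t\<ge>0. \<forall>\<^sub>F s in at_right t. X s w = X t w"
    using mc by (simp add: markov_chain_def)
  then have "AE w in M a. \<forall>\<^sub>F s in at_right t. X s w = X t w"
    by eventually_elim (use t in blast)
  ultimately have ae: "AE w in M a. \<forall>\<^sub>F n in sequentially. X (r n) w = X t w"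
    by (auto simp: filterlim_iff elim!: eventually_mono)
  have "(\<lambda>n. \<integral>w. indicator {w \<in> space (M a). X (r n) w = b} w \<partial>M a)
      \<longlonglongrightarrow> (\<integral>w. (indicator {w \<in> space (M a). X t w = b} w :: real) \<partial>M a)"
  proof (rule integral_dominated_convergence[where w = "\<lambda>_. 1"])
    show "AE w in M a. (\<lambda>n. indicator {w \<in> space (M a). X (r n) w = b} w)
        \<longlonglongrightarrow> (indicator {w \<in> space (M a). X t w = b} w :: real)"
      using ae
    proof eventually_elim
      case (elim w)
      show ?case
        by (rule tendsto_eventually) (use elim in \<open>eventually_elim, simp add: indicator_def\<close>)
    qed
  qed (use ev r t in \<open>auto intro!: AE_I2 simp: indicator_def\<close>)
  then show ?thesis
    using ev r t by (simp add: transition_matrix_def r_def[symmetric] del: of_nat_Suc)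
qed

text \<open>Expanding in the standard basis bounds \<open>N\<close> by a weighted coordinate sum;
  the reverse triangle inequality then gives continuity.\<close>

lemma is_norm_tendsto:
  fixes N :: "real ^ 'n::finite \<Rightarrow> real"
  assumes N: "is_norm N" and f: "\<And>b. (\<lambda>n. f n $ b) \<longlonglongrightarrow> x $ b"
  shows "(\<lambda>n. N (f n)) \<longlonglongrightarrow> N x"
proof -
  have N0: "\<And>x. 0 \<le> N x" "N 0 = 0" "\<And>x y. N (x + y) \<le> N x + N y"
    "\<And>c x. N (c *\<^sub>R x) = \<bar>c\<bar> * N x"
    using N by (auto simp: is_norm_def)
  have sum: "N (\<Sum>i\<in>A. g i) \<le> (\<Sum>i\<in>A. N (g i))" for A :: "'n set" and g
    using finite[of A] by (induction A) (auto simp: N0 intro: order_trans[OF N0(3)])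
  have bound: "N y \<le> (\<Sum>b\<in>UNIV. \<bar>y $ b\<bar> * N (axis b 1))" for y
  proof -
    have "y = (\<Sum>b\<in>UNIV. (y $ b) *\<^sub>R axis b 1)"
      by (simp add: vec_eq_iff axis_def if_distrib cong: if_cong)
    then have "N y = N (\<Sum>b\<in>UNIV. (y $ b) *\<^sub>R axis b 1)" by simp
    also have "\<dots> \<le> (\<Sum>b\<in>UNIV. \<bar>y $ b\<bar> * N (axis b 1))"
      by (rule order_trans[OF sum]) (simp add: N0)
    finally show ?thesis .
  qed
  have sym: "N (x - y) = N (y - x)" for x y
    using N0(4)[of "-1" "x - y"] by simp
  have diff: "\<bar>N y - N z\<bar> \<le> N (y - z)" for y z
    using N0(3)[of "y - z" z] N0(3)[of "z - y" y] sym[of y z] by simp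
  have "(\<lambda>n. \<Sum>b\<in>UNIV. \<bar>(f n - x) $ b\<bar> * N (axis b 1)) \<longlonglongrightarrow> (\<Sum>b\<in>UNIV. \<bar>x $ b - x $ b\<bar> * N (axis b 1))"
    unfolding vector_minus_component by (intro tendsto_intros f)
  then have "(\<lambda>n. \<Sum>b\<in>UNIV. \<bar>(f n - x) $ b\<bar> * N (axis b 1)) \<longlonglongrightarrow> 0" by simp
  then have "(\<lambda>n. N (f n) - N x) \<longlonglongrightarrow> 0"
    by (rule Lim_null_comparison[rotated])
      (use order_trans[OF diff bound] in \<open>auto intro!: always_eventually\<close>)
  then show ?thesis by (rule LIM_zero_cancel)
qed

lemma axis_vector_matrix_mult: "axis a 1 v* (A :: real ^ 'n ^ 'm::finite) = A $ a"
  by (simp add: vec_eq_iff vector_matrix_mult_def axis_def if_distrib[of "\<lambda>x. _ * x"] if_distrib[of "\<lambda>x. x * _"] cong: if_cong)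

text \<open>An invariant point mass would trap the chain in \<open>a\<close>, against
  irreducibility. Distinctness from \<open>\<nu>\<close> is what the decay clause of
  \<open>admissible_norm\<close> asks for.\<close>

lemma axis_not_invariant:
  fixes P :: "real \<Rightarrow> real ^ 'n::finite ^ 'n"
  assumes card: "CARD('n) \<ge> 2" and irr: "irreducible_chain P"
    and inv: "invariant_distribution P \<nu>"
  shows "axis a 1 \<noteq> \<nu>"
proof
  assume eq: "axis a 1 = \<nu>"
  obtain b where b: "b \<noteq> a"
  proof (rule ccontr)
    assume "\<not> thesis"
    with that have "(UNIV :: 'n set) = {a}" by auto
    then have "CARD('n) = card {a}" by (rule arg_cong)
    then show False using card by simp
  qed
  obtain t where t: "t \<ge> 0" "P t $ a $ b > 0" using irr by (auto simp: irreducible_chain_def)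
  then have "P t $ a = axis a 1"
    using inv by (simp add: invariant_distribution_def eq[symmetric] axis_vector_matrix_mult)
  then show False using t b by (simp add: axis_def)
qed

theorem proposition8:
  fixes M :: "'n::finite \<Rightarrow> 'w measure"
    and X :: "real \<Rightarrow> 'w \<Rightarrow> 'n"
    and P :: "real \<Rightarrow> real ^ 'n ^ 'n"
    and \<nu> :: "real ^ 'n"
    and N :: "real ^ 'n \<Rightarrow> real"
    and \<epsilon> :: real
  assumes "CARD('n) \<ge> 2"
    and "markov_chain M X"
    and "P = transition_matrix M X"
    and "irreducible_chain P"
    and "invariant_distribution P \<nu>"
    and "reversible_wrt P \<nu>"
    and "admissible_norm P N"
    and "0 < \<epsilon>" and "\<epsilon> < 1"
    and "tstar P \<nu> N \<epsilon> 1 > 0"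
  shows "(\<forall>l\<ge>1. equivp (sim P \<nu> N \<epsilon> l)) \<and>
    (\<forall>l\<ge>1. \<forall>a b. sim P \<nu> N \<epsilon> l a b \<longrightarrow> sim P \<nu> N \<epsilon> (l + 1) a b) \<and>
    (\<forall>l\<ge>1. \<forall>a b. \<not> sim P \<nu> N \<epsilon> (l - 1) a b \<and> pair_time P \<nu> N \<epsilon> a b = tstar P \<nu> N \<epsilon> l
       \<longrightarrow> sim P \<nu> N \<epsilon> l a b) \<and>
    (\<forall>a b. sim P \<nu> N \<epsilon> (CARD('n) - 1) a b)"
proof -
  have norm: "is_norm N" and le1: "\<And>p q. prob_vec p \<Longrightarrow> prob_vec q \<Longrightarrow> N (p - q) \<le> 1"
    and adm: "\<And>p q. prob_vec p \<Longrightarrow> prob_vec q \<Longrightarrow> p \<noteq> q \<Longrightarrow>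
        strict_antimono_on {0..} (\<lambda>t. N (p v* P t - q v* P t)) \<and>
        ((\<lambda>t. N (p v* P t - q v* P t)) \<longlongrightarrow> 0) at_top"
    using assms(7) by (auto simp: admissible_norm_def)
  have pv: "prob_vec \<nu>" and inv: "\<And>t. t \<ge> 0 \<Longrightarrow> \<nu> v* P t = \<nu>"
    using assms(5) by (auto simp: invariant_distribution_def)
  have pa: "prob_vec (axis a 1)" for a :: 'n
    by (auto simp: prob_vec_def axis_def)
  \<comment> \<open>The norm condition for the point mass at \<open>a\<close> against
    \<open>\<nu>\<close>. The term \<open>\<nu> v* P t\<close> stays unsimplified because invariance
    is known only for \<open>t \<ge> 0\<close>.\<close>
  have decay: "strict_antimono_on {0..} (\<lambda>t. N (P t $ a - \<nu> v* P t))"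
      "((\<lambda>t. N (P t $ a - \<nu> v* P t)) \<longlongrightarrow> 0) at_top" for a
    using adm[OF pa pv axis_not_invariant[OF assms(1,4,5)], of a]
    by (simp_all add: axis_vector_matrix_mult)
  interpret decaying_distances P \<nu> N \<epsilon>
  proof
    fix t :: real and a assume "0 \<le> t"
    then show "N (P t $ a - \<nu>) \<le> 1"
      using le1 pv prob_vec_transition_matrix[OF assms(2)] assms(3) by blast
  next
    fix s t :: real and a assume st: "0 \<le> s" "s < t"
    then have "N (P t $ a - \<nu> v* P t) < N (P s $ a - \<nu> v* P s)"
      using monotone_onD[OF decay(1), of s t] by simp
    then show "N (P t $ a - \<nu>) < N (P s $ a - \<nu>)" using st by (simp add: inv)
  next
    fix t a show "0 \<le> N (P t $ a - \<nu>)" using norm by (simp add: is_norm_def)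
  next
    fix a
    have "\<forall>\<^sub>F t in at_top. N (P t $ a - \<nu> v* P t) = N (P t $ a - \<nu>)"
      using eventually_ge_at_top[of 0] by eventually_elim (simp add: inv)
    then show "((\<lambda>t. N (P t $ a - \<nu>)) \<longlongrightarrow> 0) at_top"
      by (rule Lim_transform_eventually[OF decay(2), rotated])
  next
    fix t :: real and a assume "0 \<le> t"
    then show "(\<lambda>n. N (P (t + 1 / real (Suc n)) $ a - \<nu>)) \<longlonglongrightarrow> N (P t $ a - \<nu>)"
      unfolding assms(3) by (intro is_norm_tendsto[OF norm])
        (auto intro!: tendsto_intros transition_matrix_right_continuous[OF assms(2)] simp del: of_nat_Suc)
  qed (rule assms(8))
  note t1 = assms(10)
  have min: "sim P \<nu> N \<epsilon> l a b"
    if "l \<ge> 1" "\<not> sim P \<nu> N \<epsilon> (l - 1) a b" "pair_time P \<nu> N \<epsilon> a b = tstar P \<nu> N \<epsilon> l" for l a b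
    using sim_minimizer[OF t1, of "l - 1" a b] that by (simp add: tstar_def)
  show ?thesis
    using equivp_sim[OF t1] sim_total[OF t1 assms(1)] min sim_mono[of _ "_ + 1"]
    by (metis le_add1)
qed

end
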